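(* Fix a constant $r\in\mathbb{N}$. If $P$ is an $r$-pattern which is not $r$-partite, then \[N_P(n)=e^{O_r(n)}\, n^{(r-1)n}.\]
   Context: An (ordered) $r$-matching is an $r$-uniform hypergraph on a totally ordered vertex set in which every vertex is contained in exactly one edge; its size is its number of edges. An $r$-matching is $r$-partite if, when the vertex set is divided into $r$ contiguous intervals of equal length, every edge has exactly one vertex in each interval. An $r$-pattern is an $r$-matching of size $2$ on the vertex set $\{1,\dots,2r\}$. $N_P(n)$ denotes the number of $r$-matchings on the vertex set $\{1,\dots,rn\}$ which are $P$-free, i.e. in which no two edges (with the induced ordering on their $2r$ vertices) are order-isomorphic to $P$. Asymptotics are as $n\to\infty$; $f(n)=e^{O_r(n)}g(n)$ means that there is a constant $C$ depending only on $r$ such that $e^{-Cn}g(n)\le f(n)\le e^{Cn}g(n)$ for all sufficiently large $n$. *)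

theory Defs
  imports Complex_Main
begin

text \<open>A hypergraph on a vertex set \<open>V\<close> of a linearly ordered type is given by its set of edges.
  Edges are unordered, and so is the collection of edges.\<close>

definition r_matching :: "nat \<Rightarrow> 'a::linorder set \<Rightarrow> 'a set set \<Rightarrow> bool" where
  "r_matching r V M \<longleftrightarrow>
     finite V \<and> (\<forall>e\<in>M. e \<subseteq> V \<and> card e = r) \<and> (\<forall>v\<in>V. \<exists>!e. e \<in> M \<and> v \<in> e)"

text \<open>The \<open>i\<close>-th (counting from 0) of the \<open>r\<close> contiguous intervals of equal length
  into which \<open>V\<close> is divided: an element belongs to it according to its rank in \<open>V\<close>.\<close>

definition block :: "nat \<Rightarrow> 'a::linorder set \<Rightarrow> nat \<Rightarrow> 'a set" where
  "block r V i =
     {v \<in> V. card {u \<in> V. u < v} \<in> {i * (card V div r)..<(i + 1) * (card V div r)}}"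

lemma block_interval:
  assumes "r > 0" "i < r"
  shows "block r {1..r * n} i = {i * n + 1..(i + 1) * n}"
proof -
  have rank: "card {u \<in> {1..r * n}. u < v} = v - 1" if "v \<in> {1..r * n}" for v
  proof -
    have "{u \<in> {1..r * n}. u < v} = {1..<v}"
      using that by auto
    then show ?thesis by simp
  qed
  have le: "(i + 1) * n \<le> r * n"
    using assms by (intro mult_le_mono1) simp
  have len: "card {1..r * n} div r = n"
    using assms by simp
  have "v \<in> block r {1..r * n} i \<longleftrightarrow> v \<in> {1..r * n} \<and> v - 1 \<in> {i * n..<(i + 1) * n}" for v
    unfolding block_def len using rank by auto
  moreover have "v \<in> {1..r * n} \<and> v - 1 \<in> {i * n..<(i + 1) * n} \<longleftrightarrow> v \<in> {i * n + 1..(i + 1) * n}" for v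
    using le by auto
  ultimately show ?thesis by blast
qed

definition r_partite :: "nat \<Rightarrow> 'a::linorder set \<Rightarrow> 'a set set \<Rightarrow> bool" where
  "r_partite r V M \<longleftrightarrow> (\<forall>e\<in>M. \<forall>i<r. card (e \<inter> block r V i) = 1)"

definition r_pattern :: "nat \<Rightarrow> nat set set \<Rightarrow> bool" where
  "r_pattern r P \<longleftrightarrow> r_matching r {1..2 * r} P \<and> card P = 2"

definition order_isomorphic ::
  "'a::linorder set \<Rightarrow> 'a set set \<Rightarrow> 'b::linorder set \<Rightarrow> 'b set set \<Rightarrow> bool" where
  "order_isomorphic V H W K \<longleftrightarrow>
     (\<exists>\<phi>. bij_betw \<phi> V W \<and> strict_mono_on V \<phi> \<and> (image \<phi>) ` H = K)"

definition pattern_free :: "nat \<Rightarrow> nat set set \<Rightarrow> 'a::linorder set set \<Rightarrow> bool" where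
  "pattern_free r P M \<longleftrightarrow>
     \<not> (\<exists>e\<in>M. \<exists>f\<in>M. e \<noteq> f \<and> order_isomorphic (e \<union> f) {e, f} {1..2 * r} P)"

definition num_free :: "nat \<Rightarrow> nat set set \<Rightarrow> nat \<Rightarrow> nat" where
  "num_free r P n =
     card {M :: nat set set. r_matching r {1..r * n} M \<and> pattern_free r P M}"

text \<open>\<open>f\<close> equals \<open>g\<close> up to a factor \<open>exp (O(n))\<close>, with implied constant \<open>C\<close>. The constant is
  explicit so that a statement can say what it is allowed to depend on.\<close>

definition exp_equiv :: "real \<Rightarrow> (nat \<Rightarrow> real) \<Rightarrow> (nat \<Rightarrow> real) \<Rightarrow> bool" where
  "exp_equiv C f g \<longleftrightarrow>
     (\<forall>\<^sub>F n in sequentially.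
        exp (- C * real n) * g n \<le> f n \<and> f n \<le> exp (C * real n) * g n)"

end

theory Submission
  imports Defs "HOL-Library.FuncSet" "HOL-Combinatorics.Permutations"
begin

text \<open>Each of the two bounds comes from a crude count.

  Every pair of edges of an \<open>r\<close>-partite matching spans an \<open>r\<close>-partite pattern
  (\<open>r_partite_pair\<close>): each of the \<open>r\<close> intervals contributes two consecutive vertices to the
  union of the two edges, one from each edge. Since being \<open>r\<close>-partite is an invariant of order
  isomorphism, an \<open>r\<close>-partite matching avoids every pattern that is not \<open>r\<close>-partite. There are
  at least \<open>(n!)\<^sup>r\<^sup>-\<^sup>1\<close> matchings that are \<open>r\<close>-partite, because the bijections between the first
  interval and the others can be chosen freely (\<open>card_partite_matchings_ge\<close>), and
  \<open>n! \<ge> (n / e)\<^sup>n\<close>.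

  Conversely, there are not too many \<open>r\<close>-matchings at all: repeatedly choosing a vertex that is
  still uncovered and revealing the edge through it takes \<open>n\<close> steps with at most \<open>(r n)\<^sup>r\<^sup>-\<^sup>1\<close> choices
  each (\<open>card_r_matchings_le\<close>). So the count is at most \<open>r\<^sup>(\<^sup>r\<^sup>-\<^sup>1\<^sup>)\<^sup>n n\<^sup>(\<^sup>r\<^sup>-\<^sup>1\<^sup>)\<^sup>n\<close>, whatever the pattern.\<close>

section \<open>All matchings\<close>

lemma finite_r_matchings:
  assumes "finite V"
  shows "finite {M. r_matching r V M}"
proof (rule finite_subset)
  show "{M. r_matching r V M} \<subseteq> Pow (Pow V)"
    by (auto simp: r_matching_def)
qed (use assms in simp)

lemma r_matching_remove_edge:
  assumes "r_matching r V M" "e \<in> M"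
  shows "r_matching r (V - e) (M - {e})"
proof -
  have disj: "f \<inter> e = {}" if "f \<in> M" "f \<noteq> e" for f
    using assms that unfolding r_matching_def by blast
  have "\<exists>!f. f \<in> M - {e} \<and> v \<in> f" if "v \<in> V - e" for v
    using assms that unfolding r_matching_def by (metis DiffE DiffI singletonD)
  then show ?thesis
    using assms disj unfolding r_matching_def by blast
qed

text \<open>The base \<open>m\<close> is kept fixed while vertices are removed, so that the induction on the number
  of edges multiplies equal factors.\<close>

lemma card_r_matchings_le:
  fixes V :: "'a::linorder set"
  assumes "r > 0" "finite V" "card V = r * n" "card V \<le> m"
  shows "card {M. r_matching r V M} \<le> m ^ ((r - 1) * n)"
  using assms(2-)
proof (induction n arbitrary: V)
  case 0
  then have "V = {}" by simp
  then have "{M. r_matching r V M} \<subseteq> {{}}"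
    using \<open>r > 0\<close> unfolding r_matching_def by fastforce
  then have "card {M. r_matching r V M} \<le> card {{} :: 'a set set}"
    by (intro card_mono) auto
  then show ?case by simp
next
  case (Suc n)
  have "card V > 0" using Suc.prems \<open>r > 0\<close> by simp
  then obtain v where v: "v \<in> V" by fastforce
  define \<S> where "\<S> = {S. S \<subseteq> V - {v} \<and> card S = r - 1}"
  define \<R> where "\<R> S = {M. r_matching r (V - insert v S) M}" for S
  have fin: "finite \<S>" using Suc.prems by (simp add: \<S>_def)
  have sub: "{M. r_matching r V M} \<subseteq> (\<Union>S\<in>\<S>. insert (insert v S) ` \<R> S)"
  proof
    fix M assume "M \<in> {M. r_matching r V M}"
    then have M: "r_matching r V M" by simp
    then obtain e where e: "e \<in> M" "v \<in> e" "e \<subseteq> V" "card e = r"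
      using v unfolding r_matching_def by metis
    have "e - {v} \<in> \<S>" using e by (auto simp: \<S>_def)
    moreover have "M - {e} \<in> \<R> (e - {v})"
      using r_matching_remove_edge[OF M e(1)] e(2) by (simp add: \<R>_def insert_absorb)
    moreover have "M = insert (insert v (e - {v})) (M - {e})"
      using e(1,2) by (simp add: insert_absorb)
    ultimately show "M \<in> (\<Union>S\<in>\<S>. insert (insert v S) ` \<R> S)" by blast
  qed
  have finR: "finite (\<R> S)" for S
    unfolding \<R>_def using Suc.prems by (intro finite_r_matchings) simp
  have le: "card (\<R> S) \<le> m ^ ((r - 1) * n)" if "S \<in> \<S>" for S
  proof -
    have S: "S \<subseteq> V" "v \<notin> S" "card S = r - 1" "finite S"
      using that Suc.prems by (auto simp: \<S>_def intro: finite_subset)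
    then have "card (V - insert v S) = card V - r"
      using v \<open>r > 0\<close> by (subst card_Diff_subset) auto
    then show ?thesis
      unfolding \<R>_def using Suc.prems by (intro Suc.IH) auto
  qed
  have "card \<S> = (card V - 1) choose (r - 1)"
    unfolding \<S>_def using Suc.prems v by (subst n_subsets) auto
  also have "\<dots> \<le> (card V - 1) ^ (r - 1)"
    by (cases "r - 1 \<le> card V - 1") (simp_all add: binomial_le_pow binomial_eq_0)
  also have "\<dots> \<le> m ^ (r - 1)"
    using Suc.prems by (intro power_mono) auto
  finally have cardS: "card \<S> \<le> m ^ (r - 1)" .
  have "card {M. r_matching r V M} \<le> card (\<Union>S\<in>\<S>. insert (insert v S) ` \<R> S)"
    using sub fin finR by (intro card_mono) auto
  also have "\<dots> \<le> (\<Sum>S\<in>\<S>. card (insert (insert v S) ` \<R> S))"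
    by (rule card_UN_le[OF fin])
  also have "\<dots> \<le> (\<Sum>S\<in>\<S>. m ^ ((r - 1) * n))"
    by (intro sum_mono order_trans[OF card_image_le[OF finR] le])
  also have "\<dots> = card \<S> * m ^ ((r - 1) * n)" by simp
  also have "\<dots> \<le> m ^ (r - 1) * m ^ ((r - 1) * n)"
    using cardS by (rule mult_right_mono) simp
  also have "\<dots> = m ^ ((r - 1) * Suc n)"
    by (simp add: power_add)
  finally show ?case .
qed

section \<open>Partite matchings avoid every pattern that is not partite\<close>

text \<open>An order isomorphism preserves ranks, and the blocks are defined by ranks.\<close>

lemma image_block:
  assumes "bij_betw \<phi> V W" "strict_mono_on V \<phi>"
  shows "\<phi> ` block r V i = block r W i"
proof -
  have rank: "card {w \<in> W. w < \<phi> v} = card {u \<in> V. u < v}" if "v \<in> V" for v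
  proof -
    have "{w \<in> W. w < \<phi> v} = \<phi> ` {u \<in> V. u < v}"
      using assms that unfolding bij_betw_def
      by (auto simp: strict_mono_on_less)
    then show ?thesis
      using assms(1) by (simp add: bij_betw_def card_image inj_on_subset[of \<phi> V])
  qed
  have "card W = card V" using bij_betw_same_card[OF assms(1)] by simp
  then show ?thesis
    using assms(1) rank by (auto simp: block_def bij_betw_def)
qed

lemma r_partite_order_isomorphic:
  assumes iso: "order_isomorphic V H W K" and "\<And>e. e \<in> H \<Longrightarrow> e \<subseteq> V" "r_partite r V H"
  shows "r_partite r W K"
proof -
  obtain \<phi> where \<phi>: "bij_betw \<phi> V W" "strict_mono_on V \<phi>" "image \<phi> ` H = K"
    using iso unfolding order_isomorphic_def by blast
  have inj: "inj_on \<phi> V" using \<phi>(1) by (simp add: bij_betw_def)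
  have "card (\<phi> ` e \<inter> block r W i) = 1" if "e \<in> H" "i < r" for e i
  proof -
    have eV: "e \<subseteq> V" and bV: "block r V i \<subseteq> V"
      using assms(2) that by (auto simp: block_def)
    then have "\<phi> ` e \<inter> block r W i = \<phi> ` (e \<inter> block r V i)"
      using inj image_block[OF \<phi>(1,2)] by (simp add: inj_on_image_Int)
    moreover have "inj_on \<phi> (e \<inter> block r V i)"
      using inj eV by (blast intro: inj_on_subset)
    ultimately show ?thesis
      using assms(3) that by (simp add: card_image r_partite_def)
  qed
  then show ?thesis using \<phi>(3) by (auto simp: r_partite_def)
qed

text \<open>Here \<open>h\<close> stands for the number of the interval that contains a vertex. Below a vertex
  \<open>x\<close> of \<open>e \<union> f\<close> lie the two vertices of each of the \<open>h x\<close> earlier intervals and at most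
  one vertex of its own interval, so its rank is \<open>2 h x\<close> or \<open>2 h x + 1\<close>.\<close>

lemma r_partite_pair_of_mono_index:
  fixes h :: "'a::linorder \<Rightarrow> nat"
  assumes e: "bij_betw h e {..<r}" and f: "bij_betw h f {..<r}" and disj: "e \<inter> f = {}"
    and mono: "mono_on (e \<union> f) h"
  shows "r_partite r (e \<union> f) {e, f}"
proof -
  have fin: "finite e" "finite f"
    using bij_betw_finite[OF e] bij_betw_finite[OF f] by auto
  have cards: "card e = r" "card f = r"
    using bij_betw_same_card[OF e] bij_betw_same_card[OF f] by auto
  then have len: "card (e \<union> f) = 2 * r"
    using fin disj by (simp add: card_Un_disjoint)
  have below: "card {u \<in> g. h u < k} = k" if "bij_betw h g {..<r}" "k \<le> r" for g k
  proof -
    have "bij_betw h {u \<in> g. h u < k} {..<k}"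
      using that unfolding bij_betw_def inj_on_def
      by (auto simp: set_eq_iff image_iff) (metis less_le_trans)
    then show ?thesis using bij_betw_same_card by force
  qed
  have below2: "card {u \<in> e \<union> f. h u < k} = 2 * k" if "k \<le> r" for k
  proof -
    have "{u \<in> e \<union> f. h u < k} = {u \<in> e. h u < k} \<union> {u \<in> f. h u < k}" by auto
    also have "card \<dots> = card {u \<in> e. h u < k} + card {u \<in> f. h u < k}"
      using fin disj by (intro card_Un_disjoint) auto
    finally show ?thesis
      using below[OF e that] below[OF f that] by simp
  qed
  \<comment> \<open>Since \<open>e \<union> f\<close> has \<open>2 r\<close> vertices, its blocks consist of two consecutive ranks.\<close>
  have block_iff: "x \<in> block r (e \<union> f) i \<longleftrightarrow> h x = i" if x: "x \<in> e \<union> f" and "i < r" for x i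
  proof -
    let ?below = "{u \<in> e \<union> f. u < x}"
    have hx: "h x < r" using x e f by (auto simp: bij_betw_def)
    have "{u \<in> e \<union> f. h u < h x} \<subseteq> ?below"
      using mono x by (auto intro!: leI dest: leD mono_onD simp flip: not_le)
    then have "2 * h x \<le> card ?below"
      using card_mono[of ?below "{u \<in> e \<union> f. h u < h x}"] fin below2[of "h x"] hx by simp
    moreover have "?below \<subset> {u \<in> e \<union> f. h u < Suc (h x)}"
      using mono x by (auto simp: mono_on_def less_Suc_eq_le)
    then have "card ?below < 2 * Suc (h x)"
      using psubset_card_mono[of "{u \<in> e \<union> f. h u < Suc (h x)}" ?below] fin below2[of "Suc (h x)"] hx
      by simp
    moreover have "card (e \<union> f) div r = 2" using len hx by simp
    ultimately show ?thesis using x by (auto simp: block_def)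
  qed
  have "card (g \<inter> block r (e \<union> f) i) = 1"
    if g: "g \<subseteq> e \<union> f" "bij_betw h g {..<r}" and "i < r" for g i
  proof -
    obtain x where x: "x \<in> g" "h x = i"
      using g(2) \<open>i < r\<close> unfolding bij_betw_def by (metis imageE lessThan_iff)
    have "g \<inter> block r (e \<union> f) i = {y \<in> g. h y = i}"
      using g(1) block_iff[OF _ \<open>i < r\<close>] by blast
    also have "\<dots> = {x}"
      using x g(2) by (auto simp: bij_betw_def inj_on_def)
    finally show ?thesis by simp
  qed
  then show ?thesis using e f by (auto simp: r_partite_def)
qed

lemma r_partite_pair:
  assumes M: "r_matching r V M" and part: "r_partite r V M"
    and ef: "e \<in> M" "f \<in> M" "e \<noteq> f"
  shows "r_partite r (e \<union> f) {e, f}"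
proof (cases "r = 0")
  case True
  then show ?thesis by (simp add: r_partite_def)
next
  case False
  define h where "h v = card {u \<in> V. u < v} div (card V div r)" for v
  have fin: "finite V" using M by (simp add: r_matching_def)
  have "r \<le> card V"
    using M ef(1) card_mono[of V e] by (auto simp: r_matching_def)
  then have pos: "card V div r > 0" using False by (simp add: div_greater_zero_iff)
  have block_h: "block r V i = {v \<in> V. h v = i}" for i
    unfolding block_def h_def using pos
    by (auto simp: div_nat_eqI mult.commute dividend_less_times_div div_times_less_eq_dividend)
  have bij: "bij_betw h g {..<r}" if "g \<in> M" for g
  proof -
    have g: "g \<subseteq> V" "card g = r" using M that by (auto simp: r_matching_def)
    then have fin_g: "finite g" using fin finite_subset by blast
    have "{v \<in> g. h v = i} = g \<inter> block r V i" for i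
      using g(1) by (auto simp: block_h)
    then have one: "card {v \<in> g. h v = i} = 1" if "i < r" for i
      using part \<open>g \<in> M\<close> that by (simp add: r_partite_def)
    have "{v \<in> g. h v = i} \<noteq> {}" if "i < r" for i
      using one[OF that] by (metis card.empty zero_neq_one)
    then have "{..<r} \<subseteq> h ` g" by blast
    moreover have "card (h ` g) \<le> card {..<r}"
      using g fin_g by (auto intro: card_image_le)
    ultimately have "h ` g = {..<r}"
      using g fin_g by (intro card_seteq[symmetric]) auto
    then show ?thesis
      using g fin_g by (auto simp: bij_betw_def intro!: eq_card_imp_inj_on)
  qed
  have "e \<inter> f = {}"
    using M ef unfolding r_matching_def by blast
  moreover have "mono_on (e \<union> f) h"
    unfolding h_def using fin by (auto intro!: mono_onI div_le_mono card_mono)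
  ultimately show ?thesis
    using bij ef by (intro r_partite_pair_of_mono_index)
qed

lemma pattern_free_of_r_partite:
  assumes "r_matching r V M" "r_partite r V M" "\<not> r_partite r {1..2 * r} P"
  shows "pattern_free r P M"
  unfolding pattern_free_def
  using r_partite_pair[OF assms(1,2)] r_partite_order_isomorphic assms(3) by blast

section \<open>Partite matchings from families of permutations\<close>

text \<open>The vertex \<open>i n + a + 1\<close> is the one of rank \<open>a\<close> in the \<open>i\<close>-th of the \<open>r\<close> intervals of
  \<open>{1..r n}\<close>, and edge \<open>j\<close> meets that interval in the vertex of rank \<open>\<sigma> i j\<close>. All the
  permutations together describe a matching along with a labelling of its edges.\<close>

definition permutation_matching :: "nat \<Rightarrow> nat \<Rightarrow> (nat \<Rightarrow> nat \<Rightarrow> nat) \<Rightarrow> nat set set" where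
  "permutation_matching r n \<sigma> = (\<lambda>j. (\<lambda>i. i * n + \<sigma> i j + 1) ` {..<r}) ` {..<n}"

lemma mult_add_eq_iff:
  fixes n :: nat
  assumes "a < n" "b < n"
  shows "i * n + a = k * n + b \<longleftrightarrow> i = k \<and> a = b"
  by (metis assms add_left_cancel add.commute div_mult_self3 div_less add_cancel_right_right
      less_nat_zero_code)

context
  fixes r n :: nat and \<sigma> :: "nat \<Rightarrow> nat \<Rightarrow> nat"
  assumes perm: "\<forall>i<r. \<sigma> i permutes {..<n}"
begin

lemma permutation_less: "i < r \<Longrightarrow> j < n \<Longrightarrow> \<sigma> i j < n"
  using perm permutes_in_image by fastforce

lemma r_matching_permutation_matching:
  "r_matching r {1..r * n} (permutation_matching r n \<sigma>)"
proof -
  have "i * n + \<sigma> i j + 1 \<in> {1..r * n}" if "i < r" "j < n" for i j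
  proof -
    have "i * n + \<sigma> i j + 1 \<le> (i + 1) * n"
      using permutation_less[OF that] by simp
    also have "\<dots> \<le> r * n" using that by (intro mult_le_mono1) simp
    finally show ?thesis by simp
  qed
  moreover have "inj_on (\<lambda>i. i * n + \<sigma> i j + 1) {..<r}" if "j < n" for j
    using that by (auto simp: inj_on_def mult_add_eq_iff permutation_less)
  moreover have "\<exists>!e. e \<in> permutation_matching r n \<sigma> \<and> v \<in> e" if "v \<in> {1..r * n}" for v
  proof -
    have "n > 0" using that by (cases n) auto
    define i a where "i = (v - 1) div n" and "a = (v - 1) mod n"
    have v: "v = i * n + a + 1" using that by (simp add: i_def a_def)
    have i: "i < r" using that unfolding i_def by (intro less_mult_imp_div_less) auto
    have a: "a < n" using \<open>n > 0\<close> by (simp add: a_def)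
    have bij: "bij_betw (\<sigma> i) {..<n} {..<n}" using perm i by (simp add: permutes_imp_bij)
    then obtain j where j: "j < n" "\<sigma> i j = a"
      using a unfolding bij_betw_def by (metis imageE lessThan_iff)
    have "v \<in> (\<lambda>i. i * n + \<sigma> i k + 1) ` {..<r} \<longleftrightarrow> k = j" if "k < n" for k
    proof
      assume "v \<in> (\<lambda>i. i * n + \<sigma> i k + 1) ` {..<r}"
      then have "\<sigma> i k = \<sigma> i j"
        using a j that by (auto simp: v mult_add_eq_iff permutation_less)
      then show "k = j" using bij j that by (auto simp: bij_betw_def inj_on_def)
    qed (use v i j in auto)
    then show ?thesis
      using j unfolding permutation_matching_def by (intro ex1I[of _ "(\<lambda>i. i * n + \<sigma> i j + 1) ` {..<r}"]) auto
  qed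
  ultimately show ?thesis
    unfolding r_matching_def permutation_matching_def by (auto simp: card_image)
qed

lemma r_partite_permutation_matching:
  "r_partite r {1..r * n} (permutation_matching r n \<sigma>)"
proof -
  have "(\<lambda>i. i * n + \<sigma> i j + 1) ` {..<r} \<inter> block r {1..r * n} i = {i * n + \<sigma> i j + 1}"
    if "j < n" "i < r" for i j
  proof -
    have "k = i" if "k < r" "i * n + 1 \<le> k * n + \<sigma> k j + 1" "k * n + \<sigma> k j + 1 \<le> (i + 1) * n" for k
    proof -
      have "i = (k * n + \<sigma> k j) div n"
        using that by (intro div_nat_eqI[symmetric]) (auto simp: mult.commute)
      then show ?thesis using permutation_less[OF \<open>k < r\<close> \<open>j < n\<close>] by simp
    qed
    moreover have "i * n + \<sigma> i j + 1 \<in> {i * n + 1..(i + 1) * n}"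
      using permutation_less[OF \<open>i < r\<close> \<open>j < n\<close>] by simp
    moreover have "block r {1..r * n} i = {i * n + 1..(i + 1) * n}"
      using that by (intro block_interval) auto
    ultimately show ?thesis
      using \<open>i < r\<close> by (simp only: set_eq_iff Int_iff image_iff atLeastAtMost_iff) blast
  qed
  then show ?thesis by (auto simp: r_partite_def permutation_matching_def)
qed

text \<open>With \<open>\<sigma> 0 = id\<close> the edges are labelled by their first vertices, so the labelling can be
  read off the matching, and with it every permutation.\<close>

lemma permutation_matching_determines:
  assumes "\<sigma> 0 = id" "i < r" "j < n" "a < n"
  shows "\<sigma> i j = a \<longleftrightarrow> (\<exists>e \<in> permutation_matching r n \<sigma>. j + 1 \<in> e \<and> i * n + a + 1 \<in> e)"
proof -
  have "j + 1 \<in> (\<lambda>i. i * n + \<sigma> i k + 1) ` {..<r} \<longleftrightarrow> k = j" if "k < n" for k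
    using assms mult_add_eq_iff[of j n _ 0] that permutation_less
    by (force simp: image_iff)
  moreover have "i * n + a + 1 \<in> (\<lambda>i. i * n + \<sigma> i j + 1) ` {..<r} \<longleftrightarrow> \<sigma> i j = a"
    using assms by (auto simp: image_iff mult_add_eq_iff permutation_less)
  ultimately show ?thesis
    using assms by (auto simp: permutation_matching_def)
qed

end

lemma card_partite_matchings_ge:
  assumes "r > 0"
  shows "fact n ^ (r - 1) \<le> card {M. r_matching r {1..r * n} M \<and> r_partite r {1..r * n} M}"
proof -
  define S where "S i = (if i = 0 then {id} else {p. p permutes {..<n}})" for i :: nat
  have perm: "\<forall>i<r. \<sigma> i permutes {..<n}" if "\<sigma> \<in> PiE {..<r} S" for \<sigma>
    using that by (auto simp: S_def PiE_iff permutes_id split: if_splits)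
  have zero: "\<sigma> 0 = id" if "\<sigma> \<in> PiE {..<r} S" for \<sigma>
    using that assms by (auto simp: S_def PiE_iff Ball_def)
  have inj: "inj_on (permutation_matching r n) (PiE {..<r} S)"
  proof
    fix \<sigma> \<tau>
    assume \<sigma>: "\<sigma> \<in> PiE {..<r} S" and \<tau>: "\<tau> \<in> PiE {..<r} S"
      and eq: "permutation_matching r n \<sigma> = permutation_matching r n \<tau>"
    have "\<sigma> i = \<tau> i" if "i < r" for i
    proof
      fix j
      show "\<sigma> i j = \<tau> i j"
      proof (cases "j < n")
        case True
        have "\<tau> i j < n" using permutation_less[OF perm[OF \<tau>] that True] .
        then show ?thesis
          using permutation_matching_determines[OF perm[OF \<sigma>] zero[OF \<sigma>] that True]
            permutation_matching_determines[OF perm[OF \<tau>] zero[OF \<tau>] that True] eq by metis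
      next
        case False
        then show ?thesis
          using perm[OF \<sigma>] perm[OF \<tau>] that by (simp add: permutes_def)
      qed
    qed
    then show "\<sigma> = \<tau>" using \<sigma> \<tau> by (intro PiE_ext) auto
  qed
  have "card (PiE {..<r} S) = (\<Prod>i<r. card (S i))"
    by (rule card_PiE) simp
  also have "\<dots> = (\<Prod>i\<in>{1..<r}. card (S i))"
    using assms by (intro prod.mono_neutral_right) (auto simp: S_def)
  also have "\<dots> = (\<Prod>i\<in>{1..<r}. fact n)"
    by (intro prod.cong) (auto simp: S_def card_permutations)
  finally have "fact n ^ (r - 1) = card (PiE {..<r} S)" by simp
  also have "\<dots> = card (permutation_matching r n ` PiE {..<r} S)"
    using inj by (simp add: card_image)
  also have "\<dots> \<le> card {M. r_matching r {1..r * n} M \<and> r_partite r {1..r * n} M}"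
  proof (rule card_mono)
    show "finite {M. r_matching r {1..r * n} M \<and> r_partite r {1..r * n} M}"
      by (rule finite_subset[OF _ finite_r_matchings[of "{1..r * n}" r]]) auto
  qed (use r_matching_permutation_matching r_partite_permutation_matching perm in blast)
  finally show ?thesis .
qed

section \<open>Asymptotics\<close>

lemma exp_neg_mult_power_le_fact: "exp (- real n) * real n ^ n \<le> fact n"
proof -
  \<comment> \<open>The left-hand side is one term of the exponential series at \<open>n\<close>.\<close>
  have "real n ^ n / fact n \<le> exp (real n)"
    using sum_le_suminf[OF summable_exp, of "{n}" "real n"]
    by (simp add: exp_def field_simps)
  then show ?thesis by (simp add: exp_minus field_simps)
qed

theorem proposition1p12:
  fixes r :: nat
  shows "\<exists>C. \<forall>P. r_pattern r P \<and> \<not> r_partite r {1..2 * r} P \<longrightarrow>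
           exp_equiv C (\<lambda>n. real (num_free r P n)) (\<lambda>n. real n ^ ((r - 1) * n))"
proof (intro exI allI impI)
  fix P :: "nat set set"
  assume P: "r_pattern r P \<and> \<not> r_partite r {1..2 * r} P"
  then have "r > 0" by (cases r) (auto simp: r_partite_def)
  \<comment> \<open>The constants that arise are \<open>r - 1\<close> below and \<open>(r - 1) ln r\<close> above;
    \<open>r\<^sup>2\<close> exceeds both.\<close>
  have lower: "exp (- (real r)\<^sup>2 * real n) * real n ^ ((r - 1) * n) \<le> num_free r P n" for n
  proof -
    have "r - 1 \<le> r\<^sup>2" using self_le_power[of r 2] by (cases "r = 0") auto
    then have "real (r - 1) \<le> (real r)\<^sup>2"
      by (metis of_nat_le_iff of_nat_power)
    then have "exp (- (real r)\<^sup>2 * real n) \<le> exp (- real n) ^ (r - 1)"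
      by (simp add: exp_of_nat_mult[symmetric] mult_right_mono)
    then have "exp (- (real r)\<^sup>2 * real n) * real n ^ ((r - 1) * n)
        \<le> exp (- real n) ^ (r - 1) * real n ^ ((r - 1) * n)"
      by (intro mult_right_mono) auto
    also have "\<dots> = (exp (- real n) * real n ^ n) ^ (r - 1)"
      by (simp add: power_mult_distrib power_mult[symmetric] mult.commute)
    also have "\<dots> \<le> fact n ^ (r - 1)"
      by (intro power_mono exp_neg_mult_power_le_fact) simp
    also have "\<dots> = real (fact n ^ (r - 1))" by simp
    also have "fact n ^ (r - 1) \<le> num_free r P n"
    proof (rule order_trans[OF card_partite_matchings_ge[OF \<open>r > 0\<close>]])
      show "card {M. r_matching r {1..r * n} M \<and> r_partite r {1..r * n} M} \<le> num_free r P n"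
        unfolding num_free_def
        using P pattern_free_of_r_partite finite_r_matchings[of "{1..r * n}" r]
        by (intro card_mono) auto
    qed
    finally show ?thesis by simp
  qed
  have upper: "num_free r P n \<le> exp ((real r)\<^sup>2 * real n) * real n ^ ((r - 1) * n)" for n
  proof -
    have "num_free r P n \<le> card {M. r_matching r {1..r * n} M}"
      unfolding num_free_def using finite_r_matchings[of "{1..r * n}" r]
      by (intro card_mono) auto
    also have "\<dots> \<le> (r * n) ^ ((r - 1) * n)"
      using \<open>r > 0\<close> by (intro card_r_matchings_le) auto
    finally have "real (num_free r P n) \<le> real ((r * n) ^ ((r - 1) * n))"
      by (rule of_nat_mono)
    also have "\<dots> = real r ^ ((r - 1) * n) * real n ^ ((r - 1) * n)"
      by (simp add: power_mult_distrib)
    also have "\<dots> \<le> exp ((real r)\<^sup>2 * real n) * real n ^ ((r - 1) * n)"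
    proof (rule mult_right_mono)
      have "real r ^ ((r - 1) * n) \<le> real r ^ (r * n)"
        using \<open>r > 0\<close> by (intro power_increasing) auto
      also have "real r ^ (r * n) \<le> exp (real r) ^ (r * n)"
      proof (rule power_mono)
        show "real r \<le> exp (real r)"
          using exp_ge_add_one_self[of "real r"] by linarith
      qed simp
      also have "\<dots> = exp ((real r)\<^sup>2 * real n)"
        by (simp add: exp_of_nat_mult[symmetric] power2_eq_square mult_ac)
      finally show "real r ^ ((r - 1) * n) \<le> exp ((real r)\<^sup>2 * real n)" .
    qed simp
    finally show ?thesis .
  qed
  show "exp_equiv ((real r)\<^sup>2) (\<lambda>n. real (num_free r P n)) (\<lambda>n. real n ^ ((r - 1) * n))"
    unfolding exp_equiv_def using lower upper by simp
qed

end
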